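(* Let $p$ be a prime, let $\alpha \in \mathbb{N}$, let $R$ be a (not necessarily commutative) finite ring with $|R| = p^{\alpha}$, let $N \in \mathbb{N}$, let $X = \{x_1,\ldots,x_N\}$ be a set of $N$ variables, and let $f_1,\ldots,f_r$ be polynomial expressions over $R$ in the variables $X$. If $$N > \sum_{i=1}^r \deg(f_i),$$ then $p$ divides $|V(f_1,\ldots,f_r)|$, where $V(f_1,\ldots,f_r)$ is the set of all $\mathbf{a} \in R^N$ at which all the functions $\overline{f_1},\ldots,\overline{f_r} : R^N \to R$ induced by $f_1,\ldots,f_r$ take the value $0$.
   Context: $\mathbb{N}$ is the set of positive integers. For a (not necessarily commutative) ring $R$ and $X = \{x_1,\ldots,x_N\}$ (variables, distinct from the elements of $R$), a monomial is a nonempty word over the alphabet $R \cup X$; the set of all nonempty words is $(R\cup X)^+$. A polynomial expression over $R$ in the variables $X$ is a formal sum $\sum_{m \in (R \cup X)^+} z_m m$ with $z_m \in \mathbb{Z}$ and only finitely many $z_m \ne 0$. The degree of a monomial $y_1 y_2 \cdots y_k$ (with $y_i \in R \cup X$) is the number of $i \in \{1,\ldots,k\}$ with $y_i \in X$. The degree $\deg(f)$ of a polynomial expression $f = \sum_m z_m m$ is the maximal degree of those monomials $m$ with $z_m \neq 0$, and $\deg(0) := 0$. A polynomial expression $f$ induces the function $\overline{f} : R^N \to R$ obtained by substituting elements of $R$ for the variables, multiplying out each word in $R$, and taking the corresponding $\mathbb{Z}$-linear combination in $(R,+)$. *)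

theory Defs
  imports
    Complex_Main
    "HOL-Library.FuncSet"
    "HOL-Library.Poly_Mapping"
    "HOL-Computational_Algebra.Primes"
begin

text \<open>
  A ring is a type of class \<^class>\<open>ring\<close>: associative, with two-sided distributivity, but in general neither
  commutative nor unital. No identity element is needed, since monomials are nonempty words and
  their coefficients are integers, which act through the additive group.
\<close>

datatype 'a letter = Coeff 'a | Var nat

text \<open>Formal integer combinations of words; nonemptiness of the words and the range of the variable
  indices are imposed by \<open>poly_exprs\<close>.\<close>

type_synonym 'a poly_expr = "'a letter list \<Rightarrow>\<^sub>0 int"

definition monomials :: "nat \<Rightarrow> 'a letter list set" where
  "monomials N = {w. w \<noteq> [] \<and> set w \<subseteq> range Coeff \<union> Var ` {1..N}}"

definition poly_exprs :: "nat \<Rightarrow> 'a poly_expr set" where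
  "poly_exprs N = {f. Poly_Mapping.keys f \<subseteq> monomials N}"

fun is_var :: "'a letter \<Rightarrow> bool" where
  "is_var (Coeff c) = False"
| "is_var (Var i) = True"

definition mono_deg :: "'a letter list \<Rightarrow> nat" where
  "mono_deg w = length (filter is_var w)"

definition poly_deg :: "'a poly_expr \<Rightarrow> nat" where
  "poly_deg f = (if f = 0 then 0 else Max (mono_deg ` Poly_Mapping.keys f))"

fun letter_val :: "(nat \<Rightarrow> 'a) \<Rightarrow> 'a letter \<Rightarrow> 'a" where
  "letter_val a (Coeff c) = c"
| "letter_val a (Var i) = a i"

text \<open>The value at the empty word is a dummy: \<open>monomials\<close> excludes it, and there may be no identity.\<close>

fun mono_val :: "(nat \<Rightarrow> 'a::ring) \<Rightarrow> 'a letter list \<Rightarrow> 'a" where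
  "mono_val a [] = 0"
| "mono_val a [y] = letter_val a y"
| "mono_val a (y # z # w) = letter_val a y * mono_val a (z # w)"

text \<open>The integer multiple \<open>z \<cdot> x\<close> in the additive group; one of the two sums is always empty.\<close>

definition int_mult :: "int \<Rightarrow> 'a::ab_group_add \<Rightarrow> 'a" where
  "int_mult z x = (\<Sum>i<nat z. x) - (\<Sum>i<nat (- z). x)"

definition induced_fun :: "'a::ring poly_expr \<Rightarrow> (nat \<Rightarrow> 'a) \<Rightarrow> 'a" where
  "induced_fun f a =
    (\<Sum>m\<in>Poly_Mapping.keys f. int_mult (Poly_Mapping.lookup f m) (mono_val a m))"

text \<open>A point of \<open>R^N\<close> is a function that is \<^term>\<open>undefined\<close> outside the index set
  \<^term>\<open>{1..N}\<close>, so that each point is counted exactly once.\<close>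

definition zero_set :: "nat \<Rightarrow> nat \<Rightarrow> (nat \<Rightarrow> 'a::ring poly_expr) \<Rightarrow> (nat \<Rightarrow> 'a) set" where
  "zero_set N r f = {a \<in> {1..N} \<rightarrow>\<^sub>E UNIV. \<forall>i\<in>{1..r}. induced_fun (f i) a = 0}"

end

(* The functional degree of a map between abelian groups is the largest number of successive
   differences that do not annihilate it; it is subadditive under products and submultiplicative
   under composition, and the function induced by f has degree at most deg f. Modulo p, every
   integer function on the p-group (R,+) has degree at most some d, so the indicator of V, the
   product of the indicators of 0 composed with the f_i, has degree at most d * sum deg f_i < N * d.
   Summation over R is, up to a unit modulo p, a d-fold difference, so summation over R^N is an
   N * d-fold difference and sends this indicator to 0. *)
theory Submission
  imports Defs "HOL-Library.Function_Algebras" "HOL-Library.Multiset" "HOL-Library.Cardinality"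
begin

section \<open>Iterated differences\<close>

fun dif :: "'b::ab_group_add list \<Rightarrow> ('b \<Rightarrow> 'c::ab_group_add) \<Rightarrow> 'b \<Rightarrow> 'c" where
  "dif [] F = F"
| "dif (u # us) F = (\<lambda>x. dif us F (x + u) - dif us F x)"

lemma dif_add: "dif us (\<lambda>x. F x + G x) x = dif us F x + dif us G x"
  by (induction us arbitrary: x) simp_all

lemma dif_diff: "dif us (\<lambda>x. F x - G x) x = dif us F x - dif us G x"
  by (induction us arbitrary: x) simp_all

lemma dif_append: "dif (us @ vs) F = dif us (dif vs F)"
  by (induction us) simp_all

lemma dif_shift: "dif us (\<lambda>x. F (x + a)) x = dif us F (x + a)"
  by (induction us arbitrary: x) (simp_all add: ac_simps)

lemma dif_sum: "dif us (\<lambda>x. \<Sum>i\<in>I. F i x) x = (\<Sum>i\<in>I. dif us (F i) x)"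
  by (induction us arbitrary: x) (simp_all add: sum_subtractf)

lemma dif_mult_left:
  fixes F :: "'b::ab_group_add \<Rightarrow> 'c::ring"
  shows "dif us (\<lambda>x. c * F x) x = c * dif us F x"
  by (induction us arbitrary: x) (simp_all add: right_diff_distrib)

text \<open>Differences are additive and commute with translation, so the outermost step may be
  taken innermost.\<close>

lemma dif_Cons_commute: "dif (u # us) F = dif us (\<lambda>x. F (x + u) - F x)"
  by (rule ext) (simp add: dif_diff dif_shift)

lemma dif_insert: "dif (us @ u # vs) F = dif (u # us @ vs) F"
proof (induction us)
  case (Cons a us)
  show ?case
    unfolding append_Cons dif.simps Cons.IH
    by (rule ext) (simp add: ac_simps add_diff_eq diff_diff_eq2 diff_add_eq diff_diff_eq)
qed simp

lemma dif_mset_cong: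
  assumes "mset us = mset vs"
  shows "dif us F = dif vs F"
  using assms
proof (induction us arbitrary: vs)
  case (Cons u us)
  then have "u \<in> set vs"
    by (metis list.set_intros(1) set_mset_mset)
  then obtain ys zs where vs: "vs = ys @ u # zs"
    by (auto simp: in_set_conv_decomp)
  with Cons.prems have "mset us = mset (ys @ zs)"
    by simp
  from Cons.IH[OF this] show ?case
    unfolding vs dif_insert by simp
qed simp

text \<open>With T for translation this is the operator identity T(v+w) - 1 = (T(v) - 1) + (T(w) -
  1) + (T(v) - 1)(T(w) - 1).\<close>

lemma dif_split:
  "dif (us @ (v + w) # vs) F x
    = dif (us @ v # vs) F x + dif (us @ w # vs) F x + dif (us @ v # w # vs) F x"
  unfolding dif_insert dif_insert[of "us @ [v]", simplified]
  by (simp add: dif_insert algebra_simps)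

lemma dif_zero_step: "0 \<in> set us \<Longrightarrow> dif us F x = 0"
  by (auto simp: in_set_conv_decomp dif_insert)

lemma dif_additive:
  assumes "\<And>y z. \<phi> (y + z) = \<phi> y + \<phi> z"
  shows "dif us (\<lambda>y. F (x + \<phi> y)) y = dif (map \<phi> us) F (x + \<phi> y)"
  by (induction us arbitrary: y) (simp_all add: assms add.assoc)


section \<open>Functional degree\<close>

text \<open>Degrees are taken modulo a two-sided ideal so that one theory covers both exact
  vanishing in a ring and congruence of integers modulo \<open>p\<close>.\<close>

locale ideal_set =
  fixes M :: "'c::ring set"
  assumes zero_mem: "0 \<in> M"
    and diff_mem: "x \<in> M \<Longrightarrow> y \<in> M \<Longrightarrow> x - y \<in> M"
    and mult_left_mem: "x \<in> M \<Longrightarrow> c * x \<in> M"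
    and mult_right_mem: "x \<in> M \<Longrightarrow> x * c \<in> M"
begin

lemma add_mem: "x \<in> M \<Longrightarrow> y \<in> M \<Longrightarrow> x + y \<in> M"
  using diff_mem[of x "0 - y"] diff_mem[OF zero_mem, of y] by simp

text \<open>Modulo \<open>M\<close>, the function has functional degree less than \<open>n\<close>; \<open>n = 0\<close> means that it vanishes.\<close>

definition fdeg_lt :: "nat \<Rightarrow> ('b::ab_group_add \<Rightarrow> 'c) \<Rightarrow> bool" where
  "fdeg_lt n F \<longleftrightarrow> (\<forall>us x. length us = n \<longrightarrow> dif us F x \<in> M)"

lemma fdeg_ltD: "fdeg_lt n F \<Longrightarrow> length us = n \<Longrightarrow> dif us F x \<in> M"
  by (simp add: fdeg_lt_def)

lemma fdeg_lt_0: "fdeg_lt 0 F \<longleftrightarrow> (\<forall>x. F x \<in> M)"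
  by (simp add: fdeg_lt_def)

lemma fdeg_lt_Suc: "fdeg_lt (Suc n) F \<longleftrightarrow> (\<forall>a. fdeg_lt n (\<lambda>x. F (x + a) - F x))"
proof
  assume F: "fdeg_lt (Suc n) F"
  show "\<forall>a. fdeg_lt n (\<lambda>x. F (x + a) - F x)"
    unfolding fdeg_lt_def dif_Cons_commute[symmetric]
    using F by (auto intro!: fdeg_ltD[of "Suc n"] simp del: dif.simps)
next
  assume F: "\<forall>a. fdeg_lt n (\<lambda>x. F (x + a) - F x)"
  show "fdeg_lt (Suc n) F"
    unfolding fdeg_lt_def length_Suc_conv using F
    by (auto simp: dif_Cons_commute simp del: dif.simps intro!: fdeg_ltD[OF spec[OF F]])
qed

lemma fdeg_lt_SucI: "(\<And>a. fdeg_lt n (\<lambda>x. F (x + a) - F x)) \<Longrightarrow> fdeg_lt (Suc n) F"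
  by (simp add: fdeg_lt_Suc)

lemma fdeg_lt_Suc_mono: "fdeg_lt n F \<Longrightarrow> fdeg_lt (Suc n) F"
  unfolding fdeg_lt_def[of "Suc n"] by (auto simp: length_Suc_conv intro!: diff_mem intro: fdeg_ltD)

lemma fdeg_lt_mono: "fdeg_lt m F \<Longrightarrow> m \<le> n \<Longrightarrow> fdeg_lt n F"
  by (induction n) (auto simp: le_Suc_eq intro: fdeg_lt_Suc_mono)

lemma fdeg_lt_vanish: "(\<And>x. F x \<in> M) \<Longrightarrow> fdeg_lt n F"
  using fdeg_lt_mono[of 0 F n] by (simp add: fdeg_lt_0)

lemma fdeg_lt_add: "fdeg_lt n F \<Longrightarrow> fdeg_lt n G \<Longrightarrow> fdeg_lt n (\<lambda>x. F x + G x)"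
  unfolding fdeg_lt_def by (auto simp: dif_add intro: add_mem)

lemma fdeg_lt_diff: "fdeg_lt n F \<Longrightarrow> fdeg_lt n G \<Longrightarrow> fdeg_lt n (\<lambda>x. F x - G x)"
  unfolding fdeg_lt_def by (auto simp: dif_diff intro: diff_mem)

lemma fdeg_lt_sum:
  assumes "\<And>i. i \<in> I \<Longrightarrow> fdeg_lt n (F i)"
  shows "fdeg_lt n (\<lambda>x. \<Sum>i\<in>I. F i x)"
proof (cases "finite I")
  case True
  then show ?thesis using assms
    by (induction rule: finite_induct) (auto intro: fdeg_lt_vanish zero_mem fdeg_lt_add)
qed (auto intro: fdeg_lt_vanish zero_mem)

lemma fdeg_lt_shift: "fdeg_lt n F \<Longrightarrow> fdeg_lt n (\<lambda>x. F (x + a))"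
  unfolding fdeg_lt_def by (auto simp: dif_shift)

lemma fdeg_lt_const: "fdeg_lt (Suc 0) (\<lambda>x. c)"
  by (simp add: fdeg_lt_Suc fdeg_lt_0 zero_mem)

lemma fdeg_lt_additive:
  assumes "\<And>x y. F (x + y) = F x + F y"
  shows "fdeg_lt (Suc (Suc 0)) F"
  by (rule fdeg_lt_SucI) (simp add: assms fdeg_lt_const)

text \<open>Induction by the discrete Leibniz rule: each summand differences only one factor. The
  bounds are strict, so degrees up to \<open>m - 1\<close> and \<open>n - 1\<close> add up to less
  than \<open>K\<close>.\<close>

lemma fdeg_lt_mult:
  assumes "fdeg_lt m F" "fdeg_lt n G" "m + n \<le> Suc K"
  shows "fdeg_lt K (\<lambda>x. F x * G x)"
  using assms
proof (induction K arbitrary: m n F G)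
  case 0
  then have "m = 0 \<or> n = 0" by arith
  with "0.prems" show ?case
    by (auto simp: fdeg_lt_0 intro: mult_left_mem mult_right_mem)
next
  case (Suc K)
  consider "m = 0" | "n = 0" | m' n' where "m = Suc m'" "n = Suc n'"
    by (meson not0_implies_Suc)
  then show ?case
  proof cases
    case 3
    show ?thesis
    proof (rule fdeg_lt_SucI)
      fix a
      have "fdeg_lt K (\<lambda>x. (F (x + a) - F x) * G (x + a) + F x * (G (x + a) - G x))"
      proof (rule fdeg_lt_add)
        show "fdeg_lt K (\<lambda>x. (F (x + a) - F x) * G (x + a))"
          using Suc.prems 3 by (intro Suc.IH[of m' _ n] fdeg_lt_shift) (auto simp: fdeg_lt_Suc[of m'])
        show "fdeg_lt K (\<lambda>x. F x * (G (x + a) - G x))"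
          using Suc.prems 3 by (intro Suc.IH[of m _ n']) (auto simp: fdeg_lt_Suc[of n'])
      qed
      then show "fdeg_lt K (\<lambda>x. F (x + a) * G (x + a) - F x * G x)"
        by (simp add: algebra_simps)
    qed
  qed (use Suc.prems in \<open>auto simp: fdeg_lt_0 intro!: fdeg_lt_vanish intro: mult_left_mem mult_right_mem\<close>)
qed

end

section \<open>Differences along steps that vary with the point, and composition\<close>

interpretation zero_ideal: ideal_set "{0 :: 'c::ring}"
  by unfold_locales auto

abbreviation zdeg_lt :: "nat \<Rightarrow> ('b::ab_group_add \<Rightarrow> 'c::ring) \<Rightarrow> bool" where
  "zdeg_lt \<equiv> zero_ideal.fdeg_lt"

text \<open>A pair \<open>(u, n)\<close> is a step \<open>u x\<close> varying with the point
  \<open>x\<close>, carrying a strict bound \<open>n\<close> on the degree of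
  \<open>u\<close>.\<close>

definition eval_at :: "'b \<Rightarrow> (('b \<Rightarrow> 'd) \<times> nat) list \<Rightarrow> 'd list" where
  "eval_at x us = map (\<lambda>(u, n). u x) us"

lemma eval_at_simps [simp]:
  "eval_at x [] = []"
  "eval_at x ((u, n) # us) = u x # eval_at x us"
  "eval_at x (us @ vs) = eval_at x us @ eval_at x vs"
  "length (eval_at x us) = length us"
  by (simp_all add: eval_at_def)

definition shift_all :: "'b \<Rightarrow> (('b::plus \<Rightarrow> 'd) \<times> nat) list \<Rightarrow> (('b \<Rightarrow> 'd) \<times> nat) list" where
  "shift_all a us = map (\<lambda>(u, n). (\<lambda>x. u (x + a), n)) us"

lemma shift_all_simps [simp]:
  "shift_all a [] = []"
  "shift_all a ((u, n) # us) = (\<lambda>x. u (x + a), n) # shift_all a us"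
  "shift_all a (us @ vs) = shift_all a us @ shift_all a vs"
  by (simp_all add: shift_all_def)

lemma eval_at_shift_all: "eval_at x (shift_all a us) = eval_at (x + a) us"
  by (induction us) auto

text \<open>\<open>d * m\<close> plus this weight predicts the degree of a difference of
  \<open>g\<close> composed with \<open>f\<close>: each step lowers the degree of \<open>g\<close>
  by one, which saves \<open>d\<close>, and adds its own degree, at most
  \<open>n - 1\<close>.\<close>

definition weight :: "nat \<Rightarrow> ('e \<times> nat) list \<Rightarrow> int" where
  "weight d us = (\<Sum>(u, n)\<leftarrow>us. int n - 1 - int d)"

lemma weight_simps [simp]:
  "weight d [] = 0"
  "weight d ((u, n) # us) = int n - 1 - int d + weight d us"
  "weight d (us @ vs) = weight d us + weight d vs"
  by (simp_all add: weight_def)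

lemma weight_shift_all [simp]: "weight d (shift_all a us) = weight d us"
  by (induction us) auto

lemma weight_ge: "\<forall>(u, n)\<in>set us. n \<noteq> 0 \<Longrightarrow> - (int d * int (length us)) \<le> weight d us"
  by (induction us) (auto simp: algebra_simps)

text \<open>The cap \<open>n \<le> Suc d\<close> ensures that the difference of a step, whose bound
  drops to at most \<open>d\<close>, has negative weight.\<close>

definition bounded_degrees :: "nat \<Rightarrow> (('b::ab_group_add \<Rightarrow> 'd::ring) \<times> nat) list \<Rightarrow> bool" where
  "bounded_degrees d us \<longleftrightarrow> (\<forall>(u, n)\<in>set us. n \<le> Suc d \<and> zdeg_lt n u)"

lemma bounded_degrees_simps [simp]:
  "bounded_degrees d []"
  "bounded_degrees d ((u, n) # us) \<longleftrightarrow> n \<le> Suc d \<and> zdeg_lt n u \<and> bounded_degrees d us"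
  "bounded_degrees d (us @ vs) \<longleftrightarrow> bounded_degrees d us \<and> bounded_degrees d vs"
  by (auto simp: bounded_degrees_def)

lemma bounded_degrees_shift_all: "bounded_degrees d us \<Longrightarrow> bounded_degrees d (shift_all a us)"
  by (induction us) (auto intro: zero_ideal.fdeg_lt_shift)

context ideal_set
begin

text \<open>Differences of \<open>g\<close> are taken along steps that depend on \<open>x\<close>. Since \<open>f (x + a)\<close> and the
  shifted steps can be rewritten through differences at \<open>f x\<close>, differencing in \<open>x\<close> yields
  expressions of the same shape but smaller weight, which makes the induction go through.\<close>

lemma fdeg_lt_dif_compose:
  fixes f :: "'b::ab_group_add \<Rightarrow> 'd::ring" and g :: "'d \<Rightarrow> 'c"
  assumes g: "fdeg_lt (Suc m) g" and f: "zdeg_lt (Suc d) f"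
    and "bounded_degrees d us" "int d * int m + weight d us < int K"
  shows "fdeg_lt K (\<lambda>x. dif (eval_at x us) g (f x))"
  using assms(3,4)
proof (induction K arbitrary: us)
  case (0 us)
  show ?case
  proof (rule fdeg_lt_vanish)
    fix x
    \<comment> \<open>For \<open>K = 0\<close> the weight condition excludes at most
      \<open>m\<close> steps with nonzero bounds. More than \<open>m\<close> steps annihilate
      \<open>g\<close> modulo \<open>M\<close>, and a bound 0 forces the step itself to be
      0.\<close>
    consider "length us \<le> m" "\<forall>(u, n)\<in>set us. n \<noteq> 0" | "Suc m \<le> length us"
      | u where "(u, 0) \<in> set us"
      by (metis (mono_tags, lifting) case_prodI2 not_less_eq_eq)
    then show "dif (eval_at x us) g (f x) \<in> M"
    proof cases
      case 1
      from 1(1) have "int d * int (length us) \<le> int d * int m"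
        by (intro mult_left_mono) auto
      with weight_ge[OF 1(2), of d] "0.prems"(2) show ?thesis by simp
    next
      case 2
      then show ?thesis
        using fdeg_ltD[OF fdeg_lt_mono[OF g 2], of "eval_at x us" "f x"] by simp
    next
      case 3
      with "0.prems"(1) have "u x = 0"
        by (auto simp: bounded_degrees_def zero_ideal.fdeg_lt_0)
      with 3 have "0 \<in> set (eval_at x us)"
        by (force simp: eval_at_def)
      then show ?thesis by (simp add: dif_zero_step zero_mem)
    qed
  qed
next
  case (Suc K us)
  show ?case
  proof (cases "\<exists>u. (u, 0) \<in> set us")
    case True
    then obtain u where u: "(u, 0) \<in> set us" by blast
    show ?thesis
    proof (rule fdeg_lt_vanish)
      fix x
      from u Suc.prems(1) have "u x = 0"
        by (auto simp: bounded_degrees_def zero_ideal.fdeg_lt_0)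
      with u have "0 \<in> set (eval_at x us)"
        by (force simp: eval_at_def)
      then show "dif (eval_at x us) g (f x) \<in> M" by (simp add: dif_zero_step zero_mem)
    qed
  next
    case nonzero: False
    show ?thesis
    proof (rule fdeg_lt_SucI)
      fix a
      \<comment> \<open>The shifted steps are restored one by one from the right: \<open>vs\<close>
        is the part still shifted, \<open>ws\<close> the part already restored.\<close>
      have step: "fdeg_lt K (\<lambda>x. dif (eval_at x (shift_all a vs @ ws)) g (f x)
          - dif (eval_at x (vs @ ws)) g (f x))"
        if "bounded_degrees d (vs @ ws)" "int d * int m + weight d (vs @ ws) < int (Suc K)"
          "\<nexists>u. (u, 0) \<in> set vs" for vs ws
        using that
      proof (induction vs arbitrary: ws rule: rev_induct)
        case Nil
        then show ?case by (simp add: fdeg_lt_vanish zero_mem)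
      next
        case (snoc v vs ws)
        obtain u n' where v': "v = (u, n')" by fastforce
        with snoc.prems(3) obtain n where v: "v = (u, Suc n)"
          by (cases n') auto
        define u' where "u' = (\<lambda>x. u (x + a) - u x)"
        have u': "zdeg_lt n u'"
          using snoc.prems(1) unfolding v u'_def by (simp add: zero_ideal.fdeg_lt_Suc)
        \<comment> \<open>\<open>dif_split\<close> on \<open>u (x + a) = u x + u' x\<close> gives
          three terms. Putting \<open>u'\<close> for \<open>u\<close> lowers the weight by 1, adding
          \<open>u'\<close> lowers it by \<open>d + 1 - n > 0\<close>, and the term with
          \<open>u\<close> alone is left to the inner induction.\<close>
        have "fdeg_lt K (\<lambda>x. dif (eval_at x (shift_all a vs @ (u', n) # ws)) g (f x))"
          using snoc.prems(1,2) u'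
          by (intro Suc.IH) (auto simp: v bounded_degrees_shift_all)
        moreover have "fdeg_lt K (\<lambda>x. dif (eval_at x (shift_all a vs @ (u, Suc n) # (u', n) # ws)) g (f x))"
          using snoc.prems(1,2) u'
          by (intro Suc.IH) (auto simp: v bounded_degrees_shift_all)
        moreover have "fdeg_lt K (\<lambda>x. dif (eval_at x (shift_all a vs @ v # ws)) g (f x)
            - dif (eval_at x (vs @ v # ws)) g (f x))"
          using snoc.prems by (intro snoc.IH) auto
        ultimately have lt: "fdeg_lt K (\<lambda>x. dif (eval_at x (shift_all a vs @ (u', n) # ws)) g (f x)
            + dif (eval_at x (shift_all a vs @ (u, Suc n) # (u', n) # ws)) g (f x)
            + (dif (eval_at x (shift_all a vs @ v # ws)) g (f x)
              - dif (eval_at x (vs @ v # ws)) g (f x)))"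
          by (intro fdeg_lt_add)
        have "dif (eval_at x (shift_all a (vs @ [v]) @ ws)) g (f x)
            - dif (eval_at x ((vs @ [v]) @ ws)) g (f x)
          = dif (eval_at x (shift_all a vs @ (u', n) # ws)) g (f x)
            + dif (eval_at x (shift_all a vs @ (u, Suc n) # (u', n) # ws)) g (f x)
            + (dif (eval_at x (shift_all a vs @ v # ws)) g (f x)
              - dif (eval_at x (vs @ v # ws)) g (f x))" for x
        proof -
          have "u (x + a) = u x + u' x"
            by (simp add: u'_def)
          then show ?thesis
            by (simp add: v dif_split)
        qed
        with lt show ?case by presburger
      qed
      \<comment> \<open>Moving from \<open>f x\<close> to \<open>f (x + a)\<close> amounts to one
        more difference, along \<open>f'\<close>, and the step \<open>(f', d)\<close> has weight
        -1.\<close>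
      define f' where "f' = (\<lambda>x. f (x + a) - f x)"
      have f': "zdeg_lt d f'"
        using f unfolding f'_def by (simp add: zero_ideal.fdeg_lt_Suc)
      have "fdeg_lt K (\<lambda>x. dif (eval_at x ((f', d) # shift_all a us)) g (f x))"
        using Suc.prems f' by (intro Suc.IH) (auto simp: bounded_degrees_shift_all)
      moreover have "fdeg_lt K (\<lambda>x. dif (eval_at x (shift_all a us)) g (f x) - dif (eval_at x us) g (f x))"
        using step[of us "[]"] Suc.prems nonzero by simp
      ultimately have "fdeg_lt K (\<lambda>x. dif (eval_at x ((f', d) # shift_all a us)) g (f x)
          + (dif (eval_at x (shift_all a us)) g (f x) - dif (eval_at x us) g (f x)))"
        by (rule fdeg_lt_add)
      moreover have "f x + f' x = f (x + a)" for x
        by (simp add: f'_def)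
      ultimately show "fdeg_lt K (\<lambda>x. dif (eval_at (x + a) us) g (f (x + a)) - dif (eval_at x us) g (f x))"
        by (simp add: eval_at_shift_all)
    qed
  qed
qed

lemma fdeg_lt_compose:
  fixes f :: "'b::ab_group_add \<Rightarrow> 'd::ring"
  assumes "fdeg_lt (Suc m) g" "zdeg_lt (Suc d) f"
  shows "fdeg_lt (Suc (d * m)) (\<lambda>x. g (f x))"
  using fdeg_lt_dif_compose[OF assms, of "[]" "Suc (d * m)"] by simp

end


section \<open>The degree of an induced function\<close>

lemma zdeg_lt_letter_val: "zdeg_lt (Suc (if is_var y then 1 else 0)) (\<lambda>a. letter_val a y)"
  by (cases y) (auto intro: zero_ideal.fdeg_lt_const zero_ideal.fdeg_lt_additive)

lemma zdeg_lt_mono_val: "zdeg_lt (Suc (mono_deg w)) (\<lambda>a. mono_val a w)"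
proof (induction w rule: induct_list012)
  case 1
  then show ?case by (simp add: zero_ideal.fdeg_lt_vanish)
next
  case (2 y)
  then show ?case using zdeg_lt_letter_val[of y] by (simp add: mono_deg_def split: if_splits)
next
  case (3 y z w)
  show ?case
    using zero_ideal.fdeg_lt_mult[OF zdeg_lt_letter_val[of y] "3.IH"(2),
        of "Suc (mono_deg (y # z # w))"]
    by (simp add: mono_deg_def)
qed

lemma zdeg_lt_induced_fun: "zdeg_lt (Suc (poly_deg f)) (induced_fun f)"
proof -
  have "zdeg_lt (Suc (poly_deg f))
      (\<lambda>a. \<Sum>m\<in>Poly_Mapping.keys f. int_mult (Poly_Mapping.lookup f m) (mono_val a m))"
  proof (rule zero_ideal.fdeg_lt_sum)
    fix m assume m: "m \<in> Poly_Mapping.keys f"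
    then have "mono_deg m \<le> poly_deg f"
      by (auto simp: poly_deg_def intro: Max_ge)
    then have "zdeg_lt (Suc (poly_deg f)) (\<lambda>a. mono_val a m)"
      by (intro zero_ideal.fdeg_lt_mono[OF zdeg_lt_mono_val]) auto
    then show "zdeg_lt (Suc (poly_deg f)) (\<lambda>a. int_mult (Poly_Mapping.lookup f m) (mono_val a m))"
      \<comment> \<open>An integer multiple is a difference of sums of copies, which preserves the
        bound.\<close>
      unfolding int_mult_def
      by (intro zero_ideal.fdeg_lt_diff zero_ideal.fdeg_lt_sum)
  qed
  then show ?thesis
    unfolding induced_fun_def[abs_def] .
qed


section \<open>Integer functions modulo a prime\<close>

interpretation multiples_ideal: ideal_set "{z :: int. int p dvd z}" for p :: nat
  by unfold_locales auto

abbreviation pdeg_lt :: "nat \<Rightarrow> nat \<Rightarrow> ('b::ab_group_add \<Rightarrow> int) \<Rightarrow> bool" where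
  "pdeg_lt p \<equiv> ideal_set.fdeg_lt {z. int p dvd z}"

lemma pdeg_lt_def: "pdeg_lt p n F \<longleftrightarrow> (\<forall>us x. length us = n \<longrightarrow> int p dvd dif us F x)"
  by (simp add: multiples_ideal.fdeg_lt_def)

lemma pdeg_lt_prod:
  assumes "finite I" "\<And>i. i \<in> I \<Longrightarrow> pdeg_lt p (Suc (d i)) (F i)"
  shows "pdeg_lt p (Suc (\<Sum>i\<in>I. d i)) (\<lambda>x. \<Prod>i\<in>I. F i x)"
  using assms
proof (induction rule: finite_induct)
  case empty
  show ?case by (simp add: multiples_ideal.fdeg_lt_const)
next
  case (insert i I)
  then show ?case
    by (simp, intro multiples_ideal.fdeg_lt_mult[of p "Suc (d i)" _ "Suc (sum d I)"]) auto
qed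

lemma pdeg_lt_cancel:
  assumes "prime p" "\<not> int p dvd t" "pdeg_lt p n (\<lambda>x. t * F x)"
  shows "pdeg_lt p n F"
  using assms by (auto simp: pdeg_lt_def dif_mult_left prime_dvd_mult_iff)

lemma pdeg_lt_dif:
  assumes "pdeg_lt p (n + length vs) F"
  shows "pdeg_lt p n (dif vs F)"
  using assms by (simp add: pdeg_lt_def flip: dif_append)

text \<open>Translation by \<open>a\<close> is the identity plus the difference along
  \<open>a\<close>; its n-th power expands by the binomial theorem, here through Pascal's
  rule.\<close>

lemma newton_forward_difference:
  fixes h :: "'b::ab_group_add \<Rightarrow> int"
  shows "h (x + (\<Sum>i<n. a)) = (\<Sum>k\<le>n. int (n choose k) * dif (replicate k a) h x)"
proof (induction n arbitrary: x)
  case (Suc n)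
  define d where "d k = dif (replicate k a) h x" for k
  have d: "dif (replicate k a) h (x + a) = d (Suc k) + d k" for k
    by (simp add: d_def)
  have "h (x + (\<Sum>i<Suc n. a)) = h (x + a + (\<Sum>i<n. a))"
    by (simp add: ac_simps)
  also have "\<dots> = (\<Sum>k\<le>n. int (n choose k) * d (Suc k)) + (\<Sum>k\<le>n. int (n choose k) * d k)"
    unfolding Suc.IH d by (simp add: distrib_left sum.distrib)
  also have "(\<Sum>k\<le>n. int (n choose k) * d k) = (\<Sum>k\<le>Suc n. int (n choose k) * d k)"
    by simp
  also have "\<dots> = d 0 + (\<Sum>k\<le>n. int (n choose Suc k) * d (Suc k))"
    by (subst sum.atMost_Suc_shift) simp
  also have "(\<Sum>k\<le>n. int (n choose k) * d (Suc k)) + \<dots> = (\<Sum>k\<le>Suc n. int (Suc n choose k) * d k)"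
    unfolding sum.atMost_Suc_shift[of _ n] by (simp add: distrib_right sum.distrib)
  finally show ?case by (simp add: d_def)
qed simp

text \<open>Newton's formula for \<open>n = p\<close>: \<open>p\<close> divides all binomial
  coefficients except the two outer ones.\<close>

lemma dif_replicate_prime:
  fixes h :: "'b::ab_group_add \<Rightarrow> int"
  assumes "prime p"
  shows "int p dvd dif (replicate p a) h x - (h (x + (\<Sum>i<p. a)) - h x)"
proof -
  have p: "0 < p" using assms by (rule prime_gt_0_nat)
  have "{..p} = insert 0 (insert p {0<..<p})"
    using p by auto
  then have "h (x + (\<Sum>i<p. a)) = h x + (dif (replicate p a) h x
      + (\<Sum>k\<in>{0<..<p}. int (p choose k) * dif (replicate k a) h x))"
    unfolding newton_forward_difference using p by simp
  moreover have "int p dvd (\<Sum>k\<in>{0<..<p}. int (p choose k) * dif (replicate k a) h x)"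
    using assms by (intro dvd_sum dvd_mult2) (auto intro!: dvd_choose_prime)
  ultimately show ?thesis by simp
qed

text \<open>Modulo \<open>p\<close>, each block of \<open>p\<close> steps \<open>a\<close> merges
  into one step, \<open>p\<close> times \<open>a\<close>.\<close>

lemma dif_replicate_mult_prime:
  fixes h :: "'b::ab_group_add \<Rightarrow> int"
  assumes "prime p"
  shows "int p dvd dif (replicate (n * p) a) h x - dif (replicate n (\<Sum>i<p. a)) h x"
proof (induction n arbitrary: x)
  case (Suc n)
  define b where "b = (\<Sum>i<p. a)"
  define D where "D = dif (replicate (n * p) a) h"
  define E where "E = dif (replicate n b) h"
  have "int p dvd dif (replicate p a) D x - (D (x + b) - D x)"
    unfolding b_def by (rule dif_replicate_prime[OF assms])
  moreover have "int p dvd D (x + b) - E (x + b)" "int p dvd D x - E x"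
    using Suc.IH by (simp_all add: D_def E_def b_def)
  ultimately have "int p dvd dif (replicate p a) D x - (D (x + b) - D x)
      + ((D (x + b) - E (x + b)) - (D x - E x))"
    by (rule dvd_add[OF _ dvd_diff])
  then show ?case
    by (simp add: D_def E_def b_def replicate_add dif_append algebra_simps)
qed simp

lemma sum_const_lessThan_mult:
  fixes a :: "'b::comm_monoid_add" and m n :: nat
  shows "(\<Sum>i<m * n. a) = (\<Sum>i<m. \<Sum>j<n. a)"
proof -
  have add: "(\<Sum>i<k + l. a) = (\<Sum>i<k. a) + (\<Sum>i<l. a)" for k l :: nat
    by (induction k) (simp_all add: ac_simps)
  show ?thesis by (induction m) (simp_all add: add ac_simps)
qed

text \<open>Merging \<open>k\<close> times leaves one step, \<open>p ^ k\<close> times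
  \<open>a\<close>, which is 0. The induction passes from \<open>a\<close> to \<open>p\<close> times
  \<open>a\<close>.\<close>

lemma dif_replicate_prime_power:
  fixes h :: "'b::ab_group_add \<Rightarrow> int"
  assumes "prime p" "(\<Sum>i<p ^ k. a) = 0"
  shows "int p dvd dif (replicate (p ^ k) a) h x"
  using assms(2)
proof (induction k arbitrary: a)
  case (Suc k)
  then have "(\<Sum>i<p ^ k. \<Sum>j<p. a) = 0"
    by (simp add: sum_const_lessThan_mult[symmetric] mult.commute)
  from Suc.IH[OF this] dif_replicate_mult_prime[OF assms(1), of "p ^ k" a h x]
  show ?case
    by (metis dvd_add diff_add_cancel power_Suc2)
qed simp

text \<open>Translation by \<open>a\<close> permutes the group and so preserves the sum of all its
  elements.\<close>

lemma sum_const_card_UNIV: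
  fixes a :: "'b::{ab_group_add, finite}"
  shows "(\<Sum>i<CARD('b). a) = 0"
proof -
  obtain e :: "nat \<Rightarrow> 'b" where e: "bij_betw e {0..<CARD('b)} UNIV"
    using ex_bij_betw_nat_finite[OF finite] by blast
  have "(\<Sum>i<CARD('b). a) = (\<Sum>y\<in>(UNIV :: 'b set). a)"
    using sum.reindex_bij_betw[OF e, of "\<lambda>_. a"] by (simp add: lessThan_atLeast0)
  also have "\<dots> = (\<Sum>y\<in>UNIV. y + a) - (\<Sum>y\<in>UNIV. y)"
    by (simp add: sum.distrib)
  also have "bij (\<lambda>y. y + a)"
    by (rule bij_betw_byWitness[of _ "\<lambda>y. y - a"]) auto
  from sum.reindex_bij_betw[OF this, of "\<lambda>y. y"]
  have "(\<Sum>y\<in>UNIV. y + a) - (\<Sum>y\<in>UNIV. y) = 0"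
    by simp
  finally show ?thesis .
qed

text \<open>Pigeonhole: among \<open>q * CARD('b)\<close> steps some \<open>a\<close> occurs at
  least \<open>q\<close> times, and \<open>q\<close> equal steps already give 0 modulo
  \<open>p\<close>.\<close>

lemma pdeg_lt_bounded:
  assumes "prime p" and card: "card (UNIV :: 'b::{ab_group_add, finite} set) = p ^ k"
  shows "\<exists>n. \<forall>h :: 'b \<Rightarrow> int. pdeg_lt p n h"
proof (intro exI allI)
  fix h :: "'b \<Rightarrow> int"
  define q where "q = p ^ k"
  have q: "0 < q" using assms(1) by (simp add: q_def prime_gt_0_nat)
  show "pdeg_lt p (q * CARD('b)) h"
    unfolding pdeg_lt_def
  proof (intro allI impI)
    fix us :: "'b list" and x
    assume len: "length us = q * CARD('b)"
    have "\<exists>a. q \<le> count (mset us) a"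
    proof (rule ccontr)
      assume "\<nexists>a. q \<le> count (mset us) a"
      then have "(\<Sum>a\<in>UNIV. count (mset us) a) < (\<Sum>a\<in>(UNIV :: 'b set). q)"
        by (intro sum_strict_mono) (auto simp: not_le)
      moreover have "(\<Sum>a\<in>UNIV. count (mset us) a) = size (mset us)"
        unfolding size_multiset_overloaded_eq
        by (rule sum.mono_neutral_right) (auto simp: count_eq_zero_iff)
      ultimately show False using len by simp
    qed
    then obtain a where "q \<le> count (mset us) a" by blast
    then have sub: "replicate_mset q a \<subseteq># mset us"
      by (simp add: count_le_replicate_mset_subset_eq)
    obtain vs where "mset vs = mset us - replicate_mset q a"
      using ex_mset by blast
    with sub have "mset us = mset (replicate q a @ vs)"
      by simp
    then have "dif us h = dif (replicate q a) (dif vs h)"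
      by (simp add: dif_mset_cong[of us "replicate q a @ vs"] dif_append)
    moreover have "(\<Sum>i<p ^ k. a) = 0"
      using sum_const_card_UNIV[of a] by (simp add: card)
    ultimately show "int p dvd dif us h x"
      using dif_replicate_prime_power[OF assms(1)] by (simp add: q_def)
  qed
qed

text \<open>With \<open>\<delta>\<close> the largest functional degree that occurs, some \<open>\<delta>\<close>-fold difference is not the
  zero operator. It turns every function into a constant, so by translation invariance it is a
  multiple \<open>t\<close> of summation over the whole group.\<close>

lemma summation_as_difference:
  assumes "prime p" "1 \<le> k" and card: "card (UNIV :: 'b::{ab_group_add, finite} set) = p ^ k"
  obtains \<delta> t and us :: "'b::{ab_group_add, finite} list" where "0 < \<delta>" "length us = \<delta>" "\<not> int p dvd t"
    "\<And>h :: 'b::{ab_group_add, finite} \<Rightarrow> int. pdeg_lt p (Suc \<delta>) h"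
    "\<And>(h :: 'b::{ab_group_add, finite} \<Rightarrow> int) x. int p dvd dif us h x - t * (\<Sum>y\<in>UNIV. h y)"
proof -
  define P where "P n \<longleftrightarrow> (\<forall>h :: 'b \<Rightarrow> int. pdeg_lt p n h)" for n
  define ind :: "'b \<Rightarrow> int" where "ind z = (if z = 0 then 1 else 0)" for z
  have p: "1 < p" using assms(1) by (rule prime_gt_1_nat)
  have "\<not> pdeg_lt p 0 ind"
    using p by (auto simp: pdeg_lt_def ind_def intro!: exI[of _ 0])
  then have "\<not> P 0" by (auto simp: P_def)
  \<comment> \<open>A nonzero \<open>c\<close> exists, and differencing the point mass
    \<open>ind\<close> along it gives -1 at 0. Hence \<open>P (Suc 0)\<close> fails, which makes
    \<open>\<delta>\<close> positive.\<close>
  have "1 < p ^ k" using p assms(2) by (intro one_less_power) auto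
  then have "\<not> (UNIV :: 'b set) \<subseteq> {0}"
    using card_mono[of "{0}" "UNIV :: 'b set"] by (auto simp: card)
  then obtain c :: 'b where c: "c \<noteq> 0" by auto
  then have "dif [c] ind 0 = - 1" by (simp add: ind_def)
  then have "\<not> pdeg_lt p (Suc 0) ind"
    unfolding pdeg_lt_def using p by (auto intro!: exI[of _ "[c]"] exI[of _ 0])
  then have "\<not> P (Suc 0)" by (auto simp: P_def)
  obtain n where "P n" using pdeg_lt_bounded[OF assms(1) card] by (auto simp: P_def)
  then have "\<exists>\<delta>. \<not> P \<delta> \<and> P (Suc \<delta>)"
    using \<open>\<not> P 0\<close> by (induction n) auto
  then obtain \<delta> where \<delta>: "\<not> P \<delta>" "P (Suc \<delta>)" by blast
  from \<delta>(2) \<open>\<not> P (Suc 0)\<close> have "0 < \<delta>" by (cases \<delta>) auto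
  from \<delta>(1) obtain g :: "'b \<Rightarrow> int" and us x0
    where us: "length us = \<delta>" "\<not> int p dvd dif us g x0"
    by (auto simp: P_def pdeg_lt_def)
  \<comment> \<open>One more difference vanishes modulo \<open>p\<close>, so the
    \<open>\<delta>\<close>-fold one is constant modulo \<open>p\<close>.\<close>
  have const: "int p dvd dif us ind z - dif us ind 0" for z
  proof -
    have "int p dvd dif (z # us) ind 0"
      using \<delta>(2) us(1) unfolding P_def pdeg_lt_def by (metis length_Cons)
    then show ?thesis by simp
  qed
  have main: "int p dvd dif us h x - dif us ind 0 * (\<Sum>y\<in>UNIV. h y)" for h x
  proof -
    \<comment> \<open>\<open>h\<close> is a combination of translates of the point mass. All of them
      have the same constant difference modulo \<open>p\<close>, so \<open>dif us ind 0\<close>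
      serves as \<open>t\<close>.\<close>
    have "h = (\<lambda>x. \<Sum>y\<in>UNIV. h y * ind (x + - y))"
    proof
      fix x
      have "(\<Sum>y\<in>UNIV. h y * ind (x + - y)) = (\<Sum>y\<in>UNIV. if y = x then h y else 0)"
        by (rule sum.cong) (auto simp: ind_def)
      then show "h x = (\<Sum>y\<in>UNIV. h y * ind (x + - y))" by simp
    qed
    then have "dif us h x = dif us (\<lambda>x. \<Sum>y\<in>UNIV. h y * ind (x + - y)) x"
      by simp
    also have "\<dots> = (\<Sum>y\<in>UNIV. h y * dif us ind (x + - y))"
      unfolding dif_sum dif_mult_left dif_shift ..
    finally have "dif us h x - dif us ind 0 * (\<Sum>y\<in>UNIV. h y)
        = (\<Sum>y\<in>UNIV. h y * (dif us ind (x + - y) - dif us ind 0))"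
      by (simp add: sum_distrib_right sum_subtractf algebra_simps)
    then show ?thesis
      using const by (simp add: dvd_sum)
  qed
  have "\<not> int p dvd dif us ind 0"
    using main[of g x0] us(2) by (metis diff_add_cancel dvd_add dvd_mult2)
  with \<open>0 < \<delta>\<close> us(1) \<delta>(2) main show ?thesis
    by (intro that[of \<delta> us "dif us ind 0"]) (auto simp: P_def)
qed

section \<open>Summation over all tuples\<close>

lemma sum_PiE_insert:
  assumes "j \<notin> I"
  shows "(\<Sum>a\<in>insert j I \<rightarrow>\<^sub>E S. F a) = (\<Sum>a\<in>I \<rightarrow>\<^sub>E S. \<Sum>y\<in>S. F (a(j := y)))"
proof -
  have "(\<Sum>a\<in>insert j I \<rightarrow>\<^sub>E S. F a) = (\<Sum>(y, a)\<in>S \<times> (I \<rightarrow>\<^sub>E S). F (a(j := y)))"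
    unfolding PiE_insert_eq
    by (subst sum.reindex[OF inj_combinator[OF assms]]) (simp add: case_prod_unfold)
  then show ?thesis
    by (simp add: sum.cartesian_product[symmetric] sum.swap[of _ "I \<rightarrow>\<^sub>E S"])
qed

text \<open>Up to the unit \<open>t\<close> modulo \<open>p\<close>, summation over one coordinate
  is a difference along \<open>length us\<close> steps and consumes that much of the degree bound.
  With no coordinates left the bound is 0, so \<open>F\<close> vanishes modulo
  \<open>p\<close>.\<close>

lemma sum_PiE_low_degree:
  fixes F :: "('i \<Rightarrow> 'b::{ab_group_add, finite}) \<Rightarrow> int" and us :: "'b list"
  assumes "prime p" "\<not> int p dvd t"
    and us: "\<And>(h :: 'b \<Rightarrow> int) x. int p dvd dif us h x - t * (\<Sum>y\<in>UNIV. h y)"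
    and "finite I" "pdeg_lt p (card I * length us) F"
  shows "int p dvd (\<Sum>a\<in>I \<rightarrow>\<^sub>E UNIV. F a)"
  using assms(4,5)
proof (induction arbitrary: F rule: finite_induct)
  case empty
  then show ?case by (simp add: pdeg_lt_def)
next
  case (insert j I)
  define G where "G x = (\<Sum>y\<in>UNIV. F (x(j := y)))" for x
  \<comment> \<open>\<open>e\<close> embeds the group as the \<open>j\<close>-th axis, turning steps
    in one coordinate into steps between tuples.\<close>
  define e :: "'b \<Rightarrow> 'i \<Rightarrow> 'b" where "e y = (\<lambda>i. if i = j then y else 0)" for y
  have e_add: "e (y + z) = e y + e z" for y z
    by (auto simp: e_def)
  have e_upd: "x(j := 0) + e y = x(j := y)" for x y
    by (auto simp: e_def)
  have D: "pdeg_lt p (card I * length us) (dif (map e us) F)"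
    using insert.prems insert.hyps by (intro pdeg_lt_dif) (simp add: add.commute)
  have "int p dvd dif (map e us) F x - t * G x" for x
    \<comment> \<open>The base point \<open>x j\<close> is chosen because
      \<open>x(j := 0) + e (x j)\<close> is \<open>x\<close> again.\<close>
    using us[of "\<lambda>y. F (x(j := 0) + e y)" "x j"]
    unfolding dif_additive[of e, OF e_add] by (simp add: e_upd G_def)
  then have "pdeg_lt p (card I * length us) (\<lambda>x. dif (map e us) F x - t * G x)"
    by (intro multiples_ideal.fdeg_lt_vanish) simp
  from multiples_ideal.fdeg_lt_diff[OF D this]
  have "pdeg_lt p (card I * length us) (\<lambda>x. t * G x)" by simp
  then have "pdeg_lt p (card I * length us) G"
    by (rule pdeg_lt_cancel[OF assms(1,2)])
  then have "int p dvd (\<Sum>a\<in>I \<rightarrow>\<^sub>E UNIV. G a)" by (rule insert.IH)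
  then show ?case by (simp add: sum_PiE_insert[OF insert.hyps(2)] G_def)
qed

theorem theorem11p5:
  fixes p \<alpha> N r :: nat
    and f :: "nat \<Rightarrow> 'a::{ring, finite} poly_expr"
  assumes "prime p"
    and "\<alpha> \<ge> 1"
    and "card (UNIV :: 'a set) = p ^ \<alpha>"
    and "N \<ge> 1"
    and "\<And>i. i \<in> {1..r} \<Longrightarrow> f i \<in> poly_exprs N"
    and "N > (\<Sum>i = 1..r. poly_deg (f i))"
  shows "p dvd card (zero_set N r f)"
proof -
  obtain \<delta> t and us :: "'a list" where \<delta>: "0 < \<delta>" "length us = \<delta>" "\<not> int p dvd t"
    "\<And>h :: 'a \<Rightarrow> int. pdeg_lt p (Suc \<delta>) h"
    "\<And>(h :: 'a \<Rightarrow> int) x. int p dvd dif us h x - t * (\<Sum>y\<in>UNIV. h y)"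
    using summation_as_difference[OF assms(1-3)] by metis
  define ind :: "'a \<Rightarrow> int" where "ind z = (if z = 0 then 1 else 0)" for z
  define F where "F a = (\<Prod>i\<in>{1..r}. ind (induced_fun (f i) a))" for a
  have "pdeg_lt p (Suc (poly_deg (f i) * \<delta>)) (\<lambda>a. ind (induced_fun (f i) a))" for i
    by (rule multiples_ideal.fdeg_lt_compose[OF \<delta>(4) zdeg_lt_induced_fun])
  then have "pdeg_lt p (Suc (\<Sum>i = 1..r. poly_deg (f i) * \<delta>)) F"
    unfolding F_def[abs_def] by (intro pdeg_lt_prod) auto
  \<comment> \<open>Since \<open>\<delta> > 0\<close>, multiplying the degree hypothesis by
    \<open>\<delta>\<close> keeps it strict, and this strictness absorbs the
    \<open>Suc\<close>.\<close>
  moreover have "Suc (\<Sum>i = 1..r. poly_deg (f i) * \<delta>) \<le> card {1..N} * \<delta>"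
    using mult_strict_right_mono[OF assms(6) \<delta>(1)] by (simp add: sum_distrib_right Suc_leI)
  ultimately have "pdeg_lt p (card {1..N} * length us) F"
    unfolding \<delta>(2) by (rule multiples_ideal.fdeg_lt_mono)
  then have "int p dvd (\<Sum>a\<in>{1..N} \<rightarrow>\<^sub>E UNIV. F a)"
    by (intro sum_PiE_low_degree[OF assms(1) \<delta>(3,5)]) auto
  also have "F = (\<lambda>a. if \<forall>i\<in>{1..r}. induced_fun (f i) a = 0 then 1 else 0)"
    by (auto simp: F_def ind_def fun_eq_iff)
  also have "(\<Sum>a\<in>{1..N} \<rightarrow>\<^sub>E UNIV. if \<forall>i\<in>{1..r}. induced_fun (f i) a = 0 then 1 else 0)
      = int (card (zero_set N r f))"
    by (simp add: zero_set_def finite_PiE flip: sum.inter_filter)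
  finally show ?thesis by simp
qed

end
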